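(* For any integers $m$ and $n$ such that $m$ is divisible by $3$, $m \geq 6$, and $n \geq 100$, the $m \times n$ grid graph $G(m,n)$ has a locked $3$-omino tiling.
   Context: $G(m,n)$ denotes the $m \times n$ grid graph: its vertices are the cells of an $m \times n$ rectangular array, and two cells are adjacent exactly when they are horizontal or vertical neighbors. For a graph $G$ and a positive integer $t$, the metagraph $\mathcal{M}(G,t)$ is the graph whose vertices are the (unordered) partitions of the vertex set of $G$ into parts, each containing exactly $t$ vertices and inducing a connected subgraph of $G$; two distinct partitions are joined by an edge whenever they differ only on two parts (i.e., one is obtained from the other by replacing two parts by two other parts with the same union, all other parts being unchanged). A locked $t$-omino tiling of $G$ is an isolated vertex of $\mathcal{M}(G,t)$ that is not the only vertex of $\mathcal{M}(G,t)$. *)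

theory Defs
  imports "Graph_Theory.Graph_Theory" "HOL-Library.Disjoint_Sets"
begin

text \<open>
  As in the entry Graph_Theory, a simple undirected graph is a finite symmetric
  loop-free digraph: an edge is represented by its two orientations.
  The coercion \<^const>\<open>with_proj\<close> from pair digraphs to digraphs is inserted silently.
\<close>

definition grid_graph :: "nat \<Rightarrow> nat \<Rightarrow> (nat \<times> nat) pair_pre_digraph" where
  "grid_graph m n =
    \<lparr> pverts = {..<m} \<times> {..<n},
      parcs = {((i, j), (i', j')). i < m \<and> j < n \<and> i' < m \<and> j' < n \<and>
        (i = i' \<and> (j' = Suc j \<or> j = Suc j') \<or> j = j' \<and> (i' = Suc i \<or> i = Suc i'))} \<rparr>"

lemma pair_graph_grid_graph: "pair_graph (grid_graph m n)"
proof
  show "finite (parcs (grid_graph m n))"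
    by (rule finite_subset[of _ "({..<m} \<times> {..<n}) \<times> ({..<m} \<times> {..<n})"])
      (auto simp: grid_graph_def)
qed (auto simp: grid_graph_def symmetric_def intro!: symI)

definition connected_partitions :: "'a pair_pre_digraph \<Rightarrow> nat \<Rightarrow> 'a set set set" where
  "connected_partitions G t =
    {P. partition_on (pverts G) P \<and>
        (\<forall>A\<in>P. card A = t \<and> Digraph_Component.connected (G \<restriction> A))}"

definition differ_on_two_parts :: "'a set set \<Rightarrow> 'a set set \<Rightarrow> bool" where
  "differ_on_two_parts P Q \<longleftrightarrow> P \<noteq> Q \<and>
    (\<exists>A\<in>P. \<exists>B\<in>P. \<exists>C\<in>Q. \<exists>D\<in>Q. A \<noteq> B \<and> C \<noteq> D \<and>
       A \<union> B = C \<union> D \<and> P - {A, B} = Q - {C, D})"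

definition metagraph :: "'a pair_pre_digraph \<Rightarrow> nat \<Rightarrow> 'a set set pair_pre_digraph" where
  "metagraph G t =
    \<lparr> pverts = connected_partitions G t,
      parcs = {(P, Q). P \<in> connected_partitions G t \<and> Q \<in> connected_partitions G t \<and>
        differ_on_two_parts P Q} \<rparr>"

lemma sym_differ_on_two_parts: "differ_on_two_parts P Q \<Longrightarrow> differ_on_two_parts Q P"
  unfolding differ_on_two_parts_def by metis

lemma pair_graph_metagraph:
  assumes "finite (pverts G)"
  shows "pair_graph (metagraph G t)"
proof -
  have "connected_partitions G t \<subseteq> Pow (Pow (pverts G))"
    by (auto simp: connected_partitions_def partition_on_def)
  with assms have fin: "finite (connected_partitions G t)"
    by (meson finite_Pow_iff finite_subset)
  show ?thesis
  proof
    show "finite (pverts (metagraph G t))"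
      using fin by (simp add: metagraph_def)
    show "finite (parcs (metagraph G t))"
      by (rule finite_subset[of _ "connected_partitions G t \<times> connected_partitions G t"])
        (auto simp: metagraph_def fin)
  qed (auto simp: metagraph_def symmetric_def differ_on_two_parts_def[of P P for P]
         intro!: symI intro: sym_differ_on_two_parts)
qed

definition isolated_vertex :: "('a, 'b) pre_digraph \<Rightarrow> 'a \<Rightarrow> bool" where
  "isolated_vertex G v \<longleftrightarrow> v \<in> verts G \<and> in_arcs G v = {} \<and> out_arcs G v = {}"

definition locked_tiling :: "'a pair_pre_digraph \<Rightarrow> nat \<Rightarrow> 'a set set \<Rightarrow> bool" where
  "locked_tiling G t P \<longleftrightarrow>
    isolated_vertex (metagraph G t) P \<and> pverts (metagraph G t) \<noteq> {P}"

end

theory Submission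
  imports Defs
begin

text \<open>
  Four rectangular blocks of sizes $6 \times 8$, $6 \times 9$, $9 \times 8$ and $9 \times 9$ can be
  cut into trominoes so that no move is possible inside a block, nor across the common side of two
  blocks placed next to each other, horizontally (equal heights) or vertically (equal widths). Since
  every multiple of 3 from 6 on is a sum of 6s and 9s, and every number from 56 on is a sum of 8s and
  9s, the blocks can be laid out in rows and columns to fill the whole grid, and the result is locked.
  
  Two observations make this a finite check. First, a move replaces trominoes $A$, $B$ by
  other connected triples with the same union; one of the new triples shares two cells with $A$
  and one with $B$, so the move is nothing but the exchange of a cell of $A$ with a cell of $B$
  (\<open>exchangeable_if_repartition\<close>). A tiling without an exchangeable pair, here called interlocked, is
  therefore isolated in the metagraph (\<open>isolated_if_interlocked\<close>). Secondly, two trominoes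
  can only be exchangeable if some cell of one is adjacent to some cell of the other. Hence a pair from different blocks matters
  only if the blocks share a side, and a layout of blocks is interlocked as soon as this holds for each
  block and each pair of neighbouring blocks (\<open>mosaic_interlocked\<close>).
  
  That the locked tiling is not alone follows from the tiling by vertical trominoes, in which two
  neighbours in the same three rows are exchangeable; it is therefore a different tiling.
\<close>

section \<open>Trominoes and exchanges\<close>

type_synonym cell = "nat \<times> nat"

fun adjacent :: "cell \<Rightarrow> cell \<Rightarrow> bool" where
  "adjacent (i, j) (i', j') \<longleftrightarrow>
     i = i' \<and> (j' = Suc j \<or> j = Suc j') \<or> j = j' \<and> (i' = Suc i \<or> i = Suc i')"

definition rect :: "nat \<Rightarrow> nat \<Rightarrow> cell set" where
  "rect h w = {..<h} \<times> {..<w}"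

text \<open>
  For a set of three cells this is connectedness: every component has at least two cells, so
  there is only one. Unlike reachability, the condition can be evaluated directly.
\<close>
definition linked :: "cell set \<Rightarrow> bool" where
  "linked S \<longleftrightarrow> (\<forall>x\<in>S. \<exists>y\<in>S. adjacent x y)"

definition tromino :: "cell set \<Rightarrow> bool" where
  "tromino A \<longleftrightarrow> card A = 3 \<and> linked A"

text \<open>
  The elementary move between two tiles; for trominoes there is no other one, by
  \<open>exchangeable_if_repartition\<close> below.
\<close>
definition exchangeable :: "cell set \<Rightarrow> cell set \<Rightarrow> bool" where
  "exchangeable A B \<longleftrightarrow>
     (\<exists>a\<in>A. \<exists>b\<in>B. linked (insert b (A - {a})) \<and> linked (insert a (B - {b})))"

definition interlocked :: "cell set set \<Rightarrow> bool" where
  "interlocked P \<longleftrightarrow> (\<forall>A\<in>P. \<forall>B\<in>P. A \<noteq> B \<longrightarrow> \<not> exchangeable A B)"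

lemma adjacent_irrefl [simp]: "\<not> adjacent x x"
  by (cases x) auto

lemma adjacent_sym: "adjacent x y \<longleftrightarrow> adjacent y x"
  by (cases x; cases y) auto

lemma exchangeable_sym: "exchangeable A B \<longleftrightarrow> exchangeable B A"
  unfolding exchangeable_def by blast

text \<open>
  After the exchange, the cell received from \<open>B\<close> needs a neighbour among the remaining cells of \<open>A\<close>.
  This is what confines all interaction between tiles to neighbouring blocks.
\<close>
lemma exchangeable_imp_adjacent:
  assumes "exchangeable A B"
  obtains a b where "a \<in> A" "b \<in> B" "adjacent a b"
proof -
  from assms obtain a b where "a \<in> A" "b \<in> B" "linked (insert b (A - {a}))"
    unfolding exchangeable_def by blast
  then obtain y where "y \<in> insert b (A - {a})" "adjacent b y"
    unfolding linked_def by blast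
  with \<open>b \<in> B\<close> show thesis
    using that[of y b] by (auto simp: adjacent_sym)
qed

section \<open>Connected triples of the grid graph\<close>

lemma adjacent_subset_grid:
  assumes "A \<subseteq> rect m n"
  shows "parcs (mk_symmetric (grid_graph m n \<restriction> A)) =
    {(x, y). x \<in> A \<and> y \<in> A \<and> adjacent x y}"
proof -
  have "arcs (grid_graph m n \<restriction> A) = {(x, y). x \<in> A \<and> y \<in> A \<and> adjacent x y}"
    using assms by (auto simp: grid_graph_def rect_def)
  then show ?thesis
    using adjacent_sym by (auto simp: parcs_mk_symmetric)
qed

text \<open>
  From left to right, the first step of a path to another cell gives a neighbour. From right to
  left, if each of three cells has a neighbour among the other two, then at least two of the three
  possible adjacencies hold, and these form a path through all cells.
\<close>
lemma connected_grid_triple_iff: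
  assumes "A \<subseteq> rect m n" and card: "card A = 3"
  shows "Digraph_Component.connected (grid_graph m n \<restriction> A) \<longleftrightarrow> linked A"
proof -
  let ?S = "with_proj (mk_symmetric (grid_graph m n \<restriction> A))"
  have verts: "verts ?S = A"
    by simp
  have arcs: "arcs_ends ?S = {(x, y). x \<in> A \<and> y \<in> A \<and> adjacent x y}"
    using adjacent_subset_grid[OF assms(1)] by (simp add: arcs_ends_def)
  have reach: "x \<rightarrow>\<^sup>*\<^bsub>?S\<^esub> y \<longleftrightarrow> (x, y) \<in> rtrancl_on A {(x, y). x \<in> A \<and> y \<in> A \<and> adjacent x y}" for x y
    unfolding reachable_def verts arcs ..
  show ?thesis
  proof
    assume "Digraph_Component.connected (grid_graph m n \<restriction> A)"
    then have all: "x \<rightarrow>\<^sup>*\<^bsub>?S\<^esub> y" if "x \<in> A" "y \<in> A" for x y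
      using that unfolding Digraph_Component.connected_def strongly_connected_def by auto
    show "linked A"
      unfolding linked_def
    proof
      fix x assume x: "x \<in> A"
      have "A \<noteq> {x}"
        using card by auto
      then obtain y where y: "y \<in> A" "y \<noteq> x"
        using x by blast
      from all[OF x y(1)] y(2) show "\<exists>y\<in>A. adjacent x y"
        unfolding reach by (cases rule: converse_rtrancl_on_cases) auto
    qed
  next
    assume linked: "linked A"
    from card obtain a b c where A: "A = {a, b, c}"
      and ne: "a \<noteq> b" "a \<noteq> c" "b \<noteq> c"
      by (auto simp: card_3_iff)
    have step: "x \<rightarrow>\<^sup>*\<^bsub>?S\<^esub> y" if "x \<in> A" "y \<in> A" "adjacent x y" for x y
      unfolding reach using that by (auto intro: rtrancl_on_into_rtrancl_on)
    have trans: "x \<rightarrow>\<^sup>*\<^bsub>?S\<^esub> z" if "x \<rightarrow>\<^sup>*\<^bsub>?S\<^esub> y" "y \<rightarrow>\<^sup>*\<^bsub>?S\<^esub> z" for x y z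
      using that unfolding reach by (rule rtrancl_on_trans)
    have refl: "x \<rightarrow>\<^sup>*\<^bsub>?S\<^esub> x" if "x \<in> A" for x
      using that unfolding reach by auto
    have "(adjacent a b \<and> adjacent b c) \<or> (adjacent a b \<and> adjacent a c) \<or> (adjacent a c \<and> adjacent b c)"
      using linked adjacent_sym unfolding linked_def A
      by (metis adjacent_irrefl insert_iff empty_iff)
    then have "x \<rightarrow>\<^sup>*\<^bsub>?S\<^esub> y" if "x \<in> A" "y \<in> A" for x y
      using that step[of a b] step[of b a] step[of a c] step[of c a] step[of b c] step[of c b]
        trans refl[of x] adjacent_sym
      unfolding A by (elim insertE emptyE; metis insertI1 insertI2)
    then show "Digraph_Component.connected (grid_graph m n \<restriction> A)"
      unfolding Digraph_Component.connected_def strongly_connected_def verts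
      using A by auto
  qed
qed

lemma connected_partitions_grid_iff:
  "P \<in> connected_partitions (grid_graph m n) 3 \<longleftrightarrow>
    partition_on (rect m n) P \<and> (\<forall>A\<in>P. tromino A)"
proof -
  have verts: "pverts (grid_graph m n) = rect m n"
    by (simp add: grid_graph_def rect_def)
  have "card A = 3 \<and> Digraph_Component.connected (grid_graph m n \<restriction> A) \<longleftrightarrow> tromino A"
    if "partition_on (rect m n) P" "A \<in> P" for A
  proof -
    have "A \<subseteq> rect m n"
      using that by (auto simp: partition_on_def)
    then show ?thesis
      using connected_grid_triple_iff unfolding tromino_def by blast
  qed
  then show ?thesis
    unfolding connected_partitions_def verts by auto
qed

section \<open>Isolation through single-cell exchanges\<close>

text \<open>
  Since \<open>C\<close> is neither \<open>A\<close> nor \<open>B\<close>, it takes one or two cells from \<open>A\<close>; in the former case \<open>D\<close>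
  takes two. The one that takes two cells of \<open>A\<close> arises from \<open>A\<close> by giving one cell away and receiving
  one cell of \<open>B\<close>.
\<close>
lemma exchangeable_if_repartition:
  assumes "tromino A" "tromino B" "tromino C" "tromino D"
    and union: "A \<union> B = C \<union> D" and disj: "A \<inter> B = {}" "C \<inter> D = {}"
    and new: "C \<noteq> A" "C \<noteq> B"
  shows "exchangeable A B"
proof -
  have majority: "exchangeable A B"
    if "tromino C" "tromino D" "A \<union> B = C \<union> D" "C \<inter> D = {}" and two: "card (C \<inter> A) = 2" for C D
  proof -
    have fin: "finite A" "finite B" "finite C" "finite D"
      and card: "card A = 3" "card B = 3" "card C = 3" "card D = 3"
      using assms(1,2) that unfolding tromino_def by (auto intro: card_ge_0_finite)
    have "card (A - C) = 1"
      using card two fin by (simp add: card_Diff_subset_Int Int_commute)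
    then obtain a where a: "A - C = {a}"
      by (auto simp: card_1_singleton_iff)
    have "card (C - A) = 1"
      using card two fin by (simp add: card_Diff_subset_Int Int_commute)
    then obtain b where b: "C - A = {b}"
      by (auto simp: card_1_singleton_iff)
    have "C = insert b (A - {a})" "D = insert a (B - {b})" "a \<in> A" "b \<in> B"
      using a b that(3,4) disj(1) by blast+
    then show ?thesis
      using that(1,2) unfolding exchangeable_def tromino_def by blast
  qed
  have fin: "finite A" "finite B" "finite C" "finite D"
    and card: "card A = 3" "card B = 3" "card C = 3" "card D = 3"
    using assms(1-4) unfolding tromino_def by (auto intro: card_ge_0_finite)
  have "A = (C \<inter> A) \<union> (D \<inter> A)"
    using union by blast
  moreover have "(C \<inter> A) \<inter> (D \<inter> A) = {}"
    using disj by blast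
  ultimately have sum: "card (C \<inter> A) + card (D \<inter> A) = 3"
    using card(1) fin by (metis card_Un_disjoint finite_Int)
  have "card (C \<inter> A) \<noteq> 3"
    using card fin new(1) by (metis card_subset_eq inf_le1 inf_le2)
  moreover have "card (C \<inter> A) \<noteq> 0"
  proof
    assume "card (C \<inter> A) = 0"
    then have "C \<subseteq> B"
      using fin union by auto
    then show False
      using card fin new(2) by (metis card_subset_eq)
  qed
  ultimately consider "card (C \<inter> A) = 2" | "card (D \<inter> A) = 2"
    using sum by linarith
  then show ?thesis
    using majority[of C D] majority[of D C] assms(3,4) union disj(2)
    by cases (auto simp: Un_commute Int_commute)
qed

lemma isolated_if_interlocked:
  assumes P: "P \<in> connected_partitions (grid_graph m n) 3" and "interlocked P"
  shows "isolated_vertex (metagraph (grid_graph m n) 3) P"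
proof -
  have no_move: "\<not> differ_on_two_parts P Q" if Q: "Q \<in> connected_partitions (grid_graph m n) 3" for Q
  proof
    assume "differ_on_two_parts P Q"
    then obtain A B C D where "P \<noteq> Q" and in_P: "A \<in> P" "B \<in> P" and in_Q: "C \<in> Q" "D \<in> Q"
      and ne: "A \<noteq> B" "C \<noteq> D" and union: "A \<union> B = C \<union> D"
      and rest: "P - {A, B} = Q - {C, D}"
      unfolding differ_on_two_parts_def by (elim conjE bexE)
    have parts: "partition_on (rect m n) P" "partition_on (rect m n) Q"
      and troms: "\<And>A. A \<in> P \<Longrightarrow> tromino A" "\<And>A. A \<in> Q \<Longrightarrow> tromino A"
      using P Q by (simp_all add: connected_partitions_grid_iff)
    note trom = troms(1)[OF in_P(1)] troms(1)[OF in_P(2)] troms(2)[OF in_Q(1)] troms(2)[OF in_Q(2)]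
    have disj: "A \<inter> B = {}" "C \<inter> D = {}"
      using parts[THEN partition_onD2] in_P in_Q ne disjointD by metis+
    have "P = (P - {A, B}) \<union> {A, B}" "Q = (Q - {C, D}) \<union> {C, D}"
      using in_P in_Q by auto
    with \<open>P \<noteq> Q\<close> rest have "{A, B} \<noteq> {C, D}"
      by metis
    then have "C \<noteq> A" "C \<noteq> B"
      using union disj by blast+
    then have "exchangeable A B"
      using exchangeable_if_repartition[OF trom union disj] by blast
    then show False
      using \<open>interlocked P\<close> in_P ne unfolding interlocked_def by blast
  qed
  then show ?thesis
    using P sym_differ_on_two_parts
    unfolding isolated_vertex_def
    by (auto simp: metagraph_def in_arcs_def out_arcs_def)
qed

section \<open>Assembling blocks\<close>

definition translate :: "nat \<Rightarrow> nat \<Rightarrow> cell set \<Rightarrow> cell set" where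
  "translate r c S = (\<lambda>(i, j). (r + i, c + j)) ` S"

lemma inj_shift: "inj_on (\<lambda>(i, j). (r + i, c + j :: nat)) (S :: cell set)"
  by (auto simp: inj_on_def)

lemma linked_image:
  assumes "inj f" "\<And>x y. adjacent (f x) (f y) \<longleftrightarrow> adjacent x y"
  shows "linked (f ` S) \<longleftrightarrow> linked S"
  using assms by (auto simp: linked_def)

lemma linked_translate [simp]: "linked (translate r c S) \<longleftrightarrow> linked S"
  unfolding translate_def by (rule linked_image[OF inj_shift]) auto

lemma tromino_translate [simp]: "tromino (translate r c S) \<longleftrightarrow> tromino S"
proof -
  have "card (translate r c S) = card S"
    unfolding translate_def by (rule card_image[OF inj_shift])
  then show ?thesis
    by (simp add: tromino_def)
qed

lemma exchangeable_translate [simp]: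
  "exchangeable (translate r c A) (translate r c B) \<longleftrightarrow> exchangeable A B"
proof -
  let ?f = "\<lambda>(i, j). (r + i, c + j) :: cell"
  have swap: "insert (?f b) (?f ` S - {?f a}) = ?f ` insert b (S - {a})" for a b S
    by (simp only: image_insert image_set_diff[OF inj_shift] image_empty)
  show ?thesis
    unfolding exchangeable_def translate_def bex_simps swap
    by (simp only: translate_def[symmetric] linked_translate)
qed

lemma translate_rect: "translate r c (rect h w) = {r..<r + h} \<times> {c..<c + w}"
proof -
  have "(i, j) \<in> translate r c (rect h w)" if "(i, j) \<in> {r..<r + h} \<times> {c..<c + w}" for i j
    unfolding translate_def rect_def using that
    by (intro image_eqI[of _ _ "(i - r, j - c)"]) auto
  then show ?thesis
    by (auto simp: translate_def rect_def)
qed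

lemma partition_on_translate:
  assumes "partition_on R P"
  shows "partition_on (translate r c R) (translate r c ` P)"
proof -
  have "{} \<notin> translate r c ` P"
    using partition_onD3[OF assms] by (auto simp: translate_def)
  then show ?thesis
    using partition_on_inj_image[OF assms inj_shift, of r c]
    by (simp add: translate_def image_def)
qed

lemma partition_on_Un:
  assumes "partition_on A P" "partition_on B Q" "A \<inter> B = {}"
  shows "partition_on (A \<union> B) (P \<union> Q)"
  using assms by (simp add: partition_on_def disjoint_union)

lemma interlocked_Un:
  assumes "interlocked P" "interlocked Q" "\<And>A B. A \<in> P \<Longrightarrow> B \<in> Q \<Longrightarrow> \<not> exchangeable A B"
  shows "interlocked (P \<union> Q)"
  using assms unfolding interlocked_def by (metis Un_iff exchangeable_sym)

lemma interlocked_translate: "interlocked P \<Longrightarrow> interlocked (translate r c ` P)"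
  unfolding interlocked_def by auto

text \<open>
  A layout of blocks is given by the list of the heights of its rows and the list of the widths
  of its columns; the block in a row of height \<open>h\<close> and a column of width \<open>w\<close> is a copy of \<open>blk h w\<close>.
\<close>
fun strip :: "(nat \<Rightarrow> nat \<Rightarrow> cell set set) \<Rightarrow> nat \<Rightarrow> nat list \<Rightarrow> cell set set" where
  "strip blk h [] = {}"
| "strip blk h (w # ws) = blk h w \<union> translate 0 w ` strip blk h ws"

fun mosaic :: "(nat \<Rightarrow> nat \<Rightarrow> cell set set) \<Rightarrow> nat list \<Rightarrow> nat list \<Rightarrow> cell set set" where
  "mosaic blk [] ws = {}"
| "mosaic blk (h # hs) ws = strip blk h ws \<union> translate h 0 ` mosaic blk hs ws"

locale block_tilings =
  fixes blk :: "nat \<Rightarrow> nat \<Rightarrow> cell set set" and H W :: "nat set"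
  assumes block_partition: "h \<in> H \<Longrightarrow> w \<in> W \<Longrightarrow> partition_on (rect h w) (blk h w)"
    and block_tromino: "h \<in> H \<Longrightarrow> w \<in> W \<Longrightarrow> A \<in> blk h w \<Longrightarrow> tromino A"
begin

lemma strip_partition:
  "h \<in> H \<Longrightarrow> set ws \<subseteq> W \<Longrightarrow> partition_on (rect h (sum_list ws)) (strip blk h ws)"
proof (induction ws)
  case Nil
  then show ?case
    by (simp add: rect_def partition_on_empty)
next
  case (Cons w ws)
  have "rect h (sum_list (w # ws)) = rect h w \<union> translate 0 w (rect h (sum_list ws))"
    unfolding translate_rect by (auto simp: rect_def)
  moreover have "rect h w \<inter> translate 0 w (rect h (sum_list ws)) = {}"
    unfolding translate_rect by (auto simp: rect_def)
  moreover have "partition_on (rect h w) (blk h w)"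
    using Cons.prems by (simp add: block_partition)
  ultimately show ?case
    using Cons by (simp add: partition_on_Un partition_on_translate)
qed

lemma mosaic_partition:
  "set hs \<subseteq> H \<Longrightarrow> set ws \<subseteq> W \<Longrightarrow>
    partition_on (rect (sum_list hs) (sum_list ws)) (mosaic blk hs ws)"
proof (induction hs)
  case Nil
  then show ?case
    by (simp add: rect_def partition_on_empty)
next
  case (Cons h hs)
  have "rect (sum_list (h # hs)) (sum_list ws) =
      rect h (sum_list ws) \<union> translate h 0 (rect (sum_list hs) (sum_list ws))"
    unfolding translate_rect by (auto simp: rect_def)
  moreover have "rect h (sum_list ws) \<inter> translate h 0 (rect (sum_list hs) (sum_list ws)) = {}"
    unfolding translate_rect by (auto simp: rect_def)
  moreover have "partition_on (rect h (sum_list ws)) (strip blk h ws)"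
    using Cons.prems by (simp add: strip_partition)
  ultimately show ?case
    using Cons by (simp add: partition_on_Un partition_on_translate)
qed

lemma strip_tromino: "h \<in> H \<Longrightarrow> set ws \<subseteq> W \<Longrightarrow> A \<in> strip blk h ws \<Longrightarrow> tromino A"
  by (induction ws arbitrary: A) (auto simp: block_tromino)

lemma mosaic_tromino: "set hs \<subseteq> H \<Longrightarrow> set ws \<subseteq> W \<Longrightarrow> A \<in> mosaic blk hs ws \<Longrightarrow> tromino A"
  by (induction hs arbitrary: A) (auto simp: strip_tromino)

lemma mosaic_in_connected_partitions:
  assumes "set hs \<subseteq> H" "set ws \<subseteq> W"
  shows "mosaic blk hs ws \<in> connected_partitions (grid_graph (sum_list hs) (sum_list ws)) 3"
  using assms mosaic_partition mosaic_tromino unfolding connected_partitions_grid_iff by blast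

lemma strip_subset:
  assumes "h \<in> H" "set ws \<subseteq> W" "A \<in> strip blk h ws"
  shows "A \<subseteq> rect h (sum_list ws)"
  using partition_onD1[OF strip_partition[OF assms(1,2)]] assms(3) by blast

lemma block_subset:
  assumes "h \<in> H" "w \<in> W" "A \<in> blk h w"
  shows "A \<subseteq> rect h w"
  using partition_onD1[OF block_partition[OF assms(1,2)]] assms(3) by blast

end

text \<open>
  Only pairs of blocks that share a side are constrained. Blocks that meet in a corner contain
  no cells adjacent across the corner, and blocks further apart are separated by blocks of positive size.
\<close>
locale locking_blocks = block_tilings +
  assumes positive: "h \<in> H \<Longrightarrow> 0 < h" "w \<in> W \<Longrightarrow> 0 < w"
    and inside: "h \<in> H \<Longrightarrow> w \<in> W \<Longrightarrow> interlocked (blk h w)"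
    and beside: "h \<in> H \<Longrightarrow> w \<in> W \<Longrightarrow> w' \<in> W \<Longrightarrow> A \<in> blk h w \<Longrightarrow> B \<in> blk h w' \<Longrightarrow>
      \<not> exchangeable A (translate 0 w B)"
    and above: "h \<in> H \<Longrightarrow> h' \<in> H \<Longrightarrow> w \<in> W \<Longrightarrow> A \<in> blk h w \<Longrightarrow> B \<in> blk h' w \<Longrightarrow>
      \<not> exchangeable A (translate h 0 B)"
begin

lemma block_beside_strip:
  assumes "h \<in> H" "w \<in> W" "set ws \<subseteq> W" "A \<in> blk h w" "B \<in> strip blk h ws"
  shows "\<not> exchangeable A (translate 0 w B)"
proof (cases ws)
  case Nil
  then show ?thesis
    using assms(5) by simp
next
  case (Cons w' ws')
  then consider "B \<in> blk h w'" | B' where "B = translate 0 w' B'"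
    using assms(5) by auto
  then show ?thesis
  proof cases
    case 1
    then show ?thesis
      using beside[OF assms(1,2) _ assms(4) 1] assms(3) Cons by simp
  next
    case 2
    show ?thesis
    proof
      assume "exchangeable A (translate 0 w B)"
      then obtain a b where ab: "a \<in> A" "b \<in> translate 0 w B" "adjacent a b"
        by (rule exchangeable_imp_adjacent)
      \<comment> \<open>The block of width \<open>w'\<close> separates the two tiles.\<close>
      have "snd a < w"
        using ab(1) block_subset[OF assms(1,2,4)] by (auto simp: rect_def)
      moreover have "w + w' \<le> snd b"
        using ab(2) 2 by (auto simp: translate_def)
      moreover have "0 < w'"
        using assms(3) Cons positive by simp
      ultimately show False
        using ab(3) by (cases a; cases b) auto
    qed
  qed
qed

lemma strip_interlocked:
  "h \<in> H \<Longrightarrow> set ws \<subseteq> W \<Longrightarrow> interlocked (strip blk h ws)"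
proof (induction ws)
  case Nil
  then show ?case
    by (simp add: interlocked_def)
next
  case (Cons w ws)
  then show ?case
    using block_beside_strip[of h w ws]
    by (auto intro!: interlocked_Un interlocked_translate inside)
qed

lemma strip_above_strip:
  assumes "h \<in> H" "h' \<in> H"
  shows "set ws \<subseteq> W \<Longrightarrow> A \<in> strip blk h ws \<Longrightarrow> B \<in> strip blk h' ws \<Longrightarrow>
    \<not> exchangeable A (translate h 0 B)"
proof (induction ws arbitrary: A B)
  case Nil
  then show ?case
    by simp
next
  case (Cons w ws)
  have w: "w \<in> W" and ws: "set ws \<subseteq> W"
    using Cons.prems by auto
  \<comment> \<open>Tiles on different sides of both a horizontal and a vertical line do not touch.\<close>
  have diagonal: "\<not> exchangeable S T"
    if "S \<subseteq> {..<h} \<times> J" "T \<subseteq> {h..} \<times> K" "J \<inter> K = {}" for S T :: "cell set" and J K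
    using that by (force elim!: exchangeable_imp_adjacent)
  have commute: "translate h 0 (translate 0 w S) = translate 0 w (translate h 0 S)" for S
    by (simp add: translate_def image_image case_prod_beta)
  have block: "S \<subseteq> {..<k} \<times> {..<w}" if "k \<in> H" "S \<in> blk k w" for k S
    using block_subset[OF that(1) w that(2)] by (simp add: rect_def)
  have rest: "translate 0 w S \<subseteq> {..<k} \<times> {w..}" if "k \<in> H" "S \<in> strip blk k ws" for k S
    using strip_subset[OF that(1) ws that(2)] by (auto simp: rect_def translate_def)
  have down: "translate h 0 S \<subseteq> {h..} \<times> J" if "S \<subseteq> {..<k} \<times> J" for S k J
    using that by (auto simp: translate_def)
  have AB: "A \<in> blk h w \<or> A \<in> translate 0 w ` strip blk h ws"
    "B \<in> blk h' w \<or> B \<in> translate 0 w ` strip blk h' ws"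
    using Cons.prems by auto
  have apart: "{..<w} \<inter> {w..} = {}" "{w..} \<inter> {..<w} = {}"
    by auto
  from AB consider "A \<in> blk h w" "B \<in> blk h' w"
    | B' where "A \<in> blk h w" "B' \<in> strip blk h' ws" "B = translate 0 w B'"
    | A' where "A' \<in> strip blk h ws" "A = translate 0 w A'" "B \<in> blk h' w"
    | A' B' where "A' \<in> strip blk h ws" "A = translate 0 w A'"
        "B' \<in> strip blk h' ws" "B = translate 0 w B'"
    by blast
  then show ?case
  proof cases
    case 1
    then show ?thesis
      using assms w above by blast
  next
    case 2
    then show ?thesis
      using diagonal[OF block[OF assms(1)] down[OF rest[OF assms(2)]] apart(1)] by blast
  next
    case 3
    then show ?thesis
      using diagonal[OF rest[OF assms(1)] down[OF block[OF assms(2)]] apart(2)] by blast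
  next
    case 4
    then show ?thesis
      using Cons.IH ws by (simp add: commute)
  qed
qed

lemma strip_above_mosaic:
  assumes "h \<in> H" "set hs \<subseteq> H" "set ws \<subseteq> W" "A \<in> strip blk h ws" "B \<in> mosaic blk hs ws"
  shows "\<not> exchangeable A (translate h 0 B)"
proof (cases hs)
  case Nil
  then show ?thesis
    using assms(5) by simp
next
  case (Cons h' hs')
  then consider "B \<in> strip blk h' ws" | B' where "B = translate h' 0 B'"
    using assms(5) by auto
  then show ?thesis
  proof cases
    case 1
    then show ?thesis
      using strip_above_strip[OF assms(1) _ assms(3,4) 1] assms(2) Cons by simp
  next
    case 2
    show ?thesis
    proof
      assume "exchangeable A (translate h 0 B)"
      then obtain a b where ab: "a \<in> A" "b \<in> translate h 0 B" "adjacent a b"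
        by (rule exchangeable_imp_adjacent)
      \<comment> \<open>The row of height \<open>h'\<close> separates the two tiles.\<close>
      have "fst a < h"
        using ab(1) strip_subset[OF assms(1,3,4)] by (auto simp: rect_def)
      moreover have "h + h' \<le> fst b"
        using ab(2) 2 by (auto simp: translate_def)
      moreover have "0 < h'"
        using assms(2) Cons positive by simp
      ultimately show False
        using ab(3) by (cases a; cases b) auto
    qed
  qed
qed

lemma mosaic_interlocked:
  "set hs \<subseteq> H \<Longrightarrow> set ws \<subseteq> W \<Longrightarrow> interlocked (mosaic blk hs ws)"
proof (induction hs)
  case Nil
  then show ?case
    by (simp add: interlocked_def)
next
  case (Cons h hs)
  then show ?case
    using strip_above_mosaic[of h hs ws]
    by (auto intro!: interlocked_Un interlocked_translate strip_interlocked)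
qed

end

section \<open>Four locking blocks\<close>

text \<open>
  In the pictures, each letter marks the cells of one tromino; the letters follow the order of
  the list. The tilings depend on each other: those of equal height fit together along vertical
  borders, in either order, and those of equal width along horizontal ones; each also fits to itself.
\<close>

(*
  a a a b b b c d
  e e f f g c c d
  h e f i g g j d
  h k k i i l j j
  h m k n o l l p
  m m n n o o p p
*)
definition block_6_8 :: "cell list list" where
  "block_6_8 =
    [[(0, 0), (0, 1), (0, 2)], [(0, 3), (0, 4), (0, 5)], [(0, 6), (1, 5), (1, 6)],
     [(0, 7), (1, 7), (2, 7)], [(1, 0), (1, 1), (2, 1)], [(1, 2), (1, 3), (2, 2)],
     [(1, 4), (2, 4), (2, 5)], [(2, 0), (3, 0), (4, 0)], [(2, 3), (3, 3), (3, 4)],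
     [(2, 6), (3, 6), (3, 7)], [(3, 1), (3, 2), (4, 2)], [(3, 5), (4, 5), (4, 6)],
     [(4, 1), (5, 0), (5, 1)], [(4, 3), (5, 2), (5, 3)], [(4, 4), (5, 4), (5, 5)],
     [(4, 7), (5, 6), (5, 7)]]"

(*
  a a a b b c c d d
  e e f f b c g g d
  h e f i j j j g k
  h l l i i m n k k
  h o l p m m n n q
  o o p p r r r q q
*)
definition block_6_9 :: "cell list list" where
  "block_6_9 =
    [[(0, 0), (0, 1), (0, 2)], [(0, 3), (0, 4), (1, 4)], [(0, 5), (0, 6), (1, 5)],
     [(0, 7), (0, 8), (1, 8)], [(1, 0), (1, 1), (2, 1)], [(1, 2), (1, 3), (2, 2)],
     [(1, 6), (1, 7), (2, 7)], [(2, 0), (3, 0), (4, 0)], [(2, 3), (3, 3), (3, 4)],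
     [(2, 4), (2, 5), (2, 6)], [(2, 8), (3, 7), (3, 8)], [(3, 1), (3, 2), (4, 2)],
     [(3, 5), (4, 4), (4, 5)], [(3, 6), (4, 6), (4, 7)], [(4, 1), (5, 0), (5, 1)],
     [(4, 3), (5, 2), (5, 3)], [(4, 8), (5, 7), (5, 8)], [(5, 4), (5, 5), (5, 6)]]"

(*
  a a b b c c d d
  e a f b c g g d
  e f f h h g i i
  e j k h l l i m
  j j k k l n n m
  o p p p q n r m
  o s s q q t r r
  o u s v w t t x
  u u v v w w x x
*)
definition block_9_8 :: "cell list list" where
  "block_9_8 =
    [[(0, 0), (0, 1), (1, 1)], [(0, 2), (0, 3), (1, 3)], [(0, 4), (0, 5), (1, 4)],
     [(0, 6), (0, 7), (1, 7)], [(1, 0), (2, 0), (3, 0)], [(1, 2), (2, 1), (2, 2)],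
     [(1, 5), (1, 6), (2, 5)], [(2, 3), (2, 4), (3, 3)], [(2, 6), (2, 7), (3, 6)],
     [(3, 1), (4, 0), (4, 1)], [(3, 2), (4, 2), (4, 3)], [(3, 4), (3, 5), (4, 4)],
     [(3, 7), (4, 7), (5, 7)], [(4, 5), (4, 6), (5, 5)], [(5, 0), (6, 0), (7, 0)],
     [(5, 1), (5, 2), (5, 3)], [(5, 4), (6, 3), (6, 4)], [(5, 6), (6, 6), (6, 7)],
     [(6, 1), (6, 2), (7, 2)], [(6, 5), (7, 5), (7, 6)], [(7, 1), (8, 0), (8, 1)],
     [(7, 3), (8, 2), (8, 3)], [(7, 4), (8, 4), (8, 5)], [(7, 7), (8, 6), (8, 7)]]"

(*
  a a b b b c c d d
  e a f g h c i i d
  e f f g h h i j j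
  e k k g l l m j n
  o o k p l q m m n
  r o p p s q q t n
  r u u s s v w t t
  r x u y v v w w z
  x x y y A A A z z
*)
definition block_9_9 :: "cell list list" where
  "block_9_9 =
    [[(0, 0), (0, 1), (1, 1)], [(0, 2), (0, 3), (0, 4)], [(0, 5), (0, 6), (1, 5)],
     [(0, 7), (0, 8), (1, 8)], [(1, 0), (2, 0), (3, 0)], [(1, 2), (2, 1), (2, 2)],
     [(1, 3), (2, 3), (3, 3)], [(1, 4), (2, 4), (2, 5)], [(1, 6), (1, 7), (2, 6)],
     [(2, 7), (2, 8), (3, 7)], [(3, 1), (3, 2), (4, 2)], [(3, 4), (3, 5), (4, 4)],
     [(3, 6), (4, 6), (4, 7)], [(3, 8), (4, 8), (5, 8)], [(4, 0), (4, 1), (5, 1)],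
     [(4, 3), (5, 2), (5, 3)], [(4, 5), (5, 5), (5, 6)], [(5, 0), (6, 0), (7, 0)],
     [(5, 4), (6, 3), (6, 4)], [(5, 7), (6, 7), (6, 8)], [(6, 1), (6, 2), (7, 2)],
     [(6, 5), (7, 4), (7, 5)], [(6, 6), (7, 6), (7, 7)], [(7, 1), (8, 0), (8, 1)],
     [(7, 3), (8, 2), (8, 3)], [(7, 8), (8, 7), (8, 8)], [(8, 4), (8, 5), (8, 6)]]"

definition block_list :: "nat \<Rightarrow> nat \<Rightarrow> cell list list" where
  "block_list h w =
    (if h = 6 then if w = 8 then block_6_8 else block_6_9
     else if w = 8 then block_9_8 else block_9_9)"

definition block :: "nat \<Rightarrow> nat \<Rightarrow> cell set set" where
  "block h w = set ` set (block_list h w)"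

text \<open>
  A list of \<open>h * w\<close> distinct cells in the rectangle of size \<open>h\<close> by \<open>w\<close> exhausts the rectangle, so
  these conditions amount to a tiling.
\<close>
lemma block_list_cells:
  "\<forall>h\<in>{6, 9}. \<forall>w\<in>{8, 9}.
    distinct (concat (block_list h w)) \<and> length (concat (block_list h w)) = h * w \<and>
    (\<forall>(i, j)\<in>set (concat (block_list h w)). i < h \<and> j < w)"
  by code_simp

lemma block_list_trominoes:
  "\<forall>h\<in>{6, 9}. \<forall>w\<in>{8, 9}. \<forall>A\<in>set (block_list h w). length A = 3 \<and> linked (set A)"
  by code_simp

lemma block_list_inside:
  "\<forall>h\<in>{6, 9}. \<forall>w\<in>{8, 9}.
    sorted_wrt (\<lambda>A B. \<not> exchangeable (set A) (set B)) (block_list h w)"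
  by code_simp

text \<open>
  A tile on the left of a vertical line and a tile on its right can only interact if they
  reach the line, so it suffices to examine the border tiles.
\<close>
lemma block_list_beside:
  "\<forall>h\<in>{6, 9}. \<forall>w\<in>{8, 9}. \<forall>w'\<in>{8, 9}.
    \<forall>A\<in>set (filter (\<lambda>A. \<exists>x\<in>set A. Suc (snd x) = w) (block_list h w)).
    \<forall>B\<in>set (filter (\<lambda>B. \<exists>x\<in>set B. snd x = 0) (block_list h w')).
      \<not> exchangeable (set A) (translate 0 w (set B))"
  by code_simp

lemma block_list_above:
  "\<forall>h\<in>{6, 9}. \<forall>h'\<in>{6, 9}. \<forall>w\<in>{8, 9}.
    \<forall>A\<in>set (filter (\<lambda>A. \<exists>x\<in>set A. Suc (fst x) = h) (block_list h w)).
    \<forall>B\<in>set (filter (\<lambda>B. \<exists>x\<in>set B. fst x = 0) (block_list h' w)).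
      \<not> exchangeable (set A) (translate h 0 (set B))"
  by code_simp

lemma partition_on_lists:
  assumes "distinct (concat ts)" "[] \<notin> set ts"
  shows "partition_on (set (concat ts)) (set ` set ts)"
  using assms
proof (induction ts)
  case Nil
  then show ?case
    by (simp add: partition_on_empty)
next
  case (Cons t ts)
  have "partition_on (set t \<union> set (concat ts)) ({set t} \<union> set ` set ts)"
    using Cons by (intro partition_on_Un partition_on_space) auto
  then show ?case
    by simp
qed

lemma border_cells_if_exchangeable_beside:
  assumes "exchangeable A (translate 0 w B)" "A \<subseteq> rect h w"
  shows "(\<exists>x\<in>A. Suc (snd x) = w) \<and> (\<exists>x\<in>B. snd x = 0)"
proof -
  obtain a b where ab: "a \<in> A" "b \<in> B" "adjacent a (fst b, w + snd b)"
    using assms(1) by (force elim!: exchangeable_imp_adjacent simp: translate_def)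
  moreover have "snd a < w"
    using ab(1) assms(2) by (auto simp: rect_def)
  ultimately have "Suc (snd a) = w \<and> snd b = 0"
    by (cases a) auto
  then show ?thesis
    using ab(1,2) by blast
qed

lemma border_cells_if_exchangeable_above:
  assumes "exchangeable A (translate h 0 B)" "A \<subseteq> rect h w"
  shows "(\<exists>x\<in>A. Suc (fst x) = h) \<and> (\<exists>x\<in>B. fst x = 0)"
proof -
  obtain a b where ab: "a \<in> A" "b \<in> B" "adjacent a (h + fst b, snd b)"
    using assms(1) by (force elim!: exchangeable_imp_adjacent simp: translate_def)
  moreover have "fst a < h"
    using ab(1) assms(2) by (auto simp: rect_def)
  ultimately have "Suc (fst a) = h \<and> fst b = 0"
    by (cases a) auto
  then show ?thesis
    using ab(1,2) by blast
qed

lemma interlocked_if_sorted_wrt: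
  assumes "sorted_wrt (\<lambda>A B. \<not> exchangeable (set A) (set B)) ts"
  shows "interlocked (set ` set ts)"
  using assms by (induction ts) (auto simp: interlocked_def exchangeable_sym)

interpretation block_tilings block "{6, 9}" "{8, 9}"
proof
  fix h w :: nat
  assume hw: "h \<in> {6, 9}" "w \<in> {8, 9}"
  have cells: "distinct (concat (block_list h w))" "length (concat (block_list h w)) = h * w"
    "set (concat (block_list h w)) \<subseteq> rect h w"
    using block_list_cells hw unfolding rect_def by fast+
  have tiles: "length A = 3" "linked (set A)" if "A \<in> set (block_list h w)" for A
    using block_list_trominoes hw that by blast+
  have "card (set (concat (block_list h w))) = card (rect h w)"
    using distinct_card[OF cells(1)] cells(2) by (simp add: rect_def)
  with cells(3) have "set (concat (block_list h w)) = rect h w"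
    by (intro card_subset_eq) (auto simp: rect_def)
  moreover have "[] \<notin> set (block_list h w)"
    using tiles(1) by force
  ultimately show "partition_on (rect h w) (block h w)"
    using partition_on_lists[OF cells(1)] unfolding block_def by simp
  fix A
  assume "A \<in> block h w"
  then obtain t where t: "t \<in> set (block_list h w)" "A = set t"
    unfolding block_def by blast
  have "distinct t"
    using cells(1) t(1) by (simp add: distinct_concat_iff)
  then show "tromino A"
    using tiles[OF t(1)] t(2) by (simp add: tromino_def distinct_card)
qed

interpretation locking_blocks block "{6, 9}" "{8, 9}"
proof
  fix h w :: nat
  show "0 < h" if "h \<in> {6, 9}"
    using that by auto
  show "0 < w" if "w \<in> {8, 9}"
    using that by auto
  show "interlocked (block h w)" if "h \<in> {6, 9}" "w \<in> {8, 9}"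
    using block_list_inside that unfolding block_def by (intro interlocked_if_sorted_wrt) blast
  show "\<not> exchangeable A (translate 0 w B)"
    if hw: "h \<in> {6, 9}" "w \<in> {8, 9}" "w' \<in> {8, 9}" and A: "A \<in> block h w" and B: "B \<in> block h w'"
    for w' A B
  proof
    assume ex: "exchangeable A (translate 0 w B)"
    obtain s t where st: "s \<in> set (block_list h w)" "A = set s" "t \<in> set (block_list h w')" "B = set t"
      using A B unfolding block_def by blast
    have "s \<in> set (filter (\<lambda>A. \<exists>x\<in>set A. Suc (snd x) = w) (block_list h w))"
      "t \<in> set (filter (\<lambda>B. \<exists>x\<in>set B. snd x = 0) (block_list h w'))"
      using border_cells_if_exchangeable_beside[OF ex block_subset[OF hw(1,2) A]] st by simp_all
    then show False
      using block_list_beside hw ex st(2,4) by blast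
  qed
  show "\<not> exchangeable A (translate h 0 B)"
    if hw: "h \<in> {6, 9}" "h' \<in> {6, 9}" "w \<in> {8, 9}" and A: "A \<in> block h w" and B: "B \<in> block h' w"
    for h' A B
  proof
    assume ex: "exchangeable A (translate h 0 B)"
    obtain s t where st: "s \<in> set (block_list h w)" "A = set s" "t \<in> set (block_list h' w)" "B = set t"
      using A B unfolding block_def by blast
    have "s \<in> set (filter (\<lambda>A. \<exists>x\<in>set A. Suc (fst x) = h) (block_list h w))"
      "t \<in> set (filter (\<lambda>B. \<exists>x\<in>set B. fst x = 0) (block_list h' w))"
      using border_cells_if_exchangeable_above[OF ex block_subset[OF hw(1,3) A]] st by simp_all
    then show False
      using block_list_above hw ex st(2,4) by blast
  qed
qed

section \<open>A second tiling\<close>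

interpretation columns: block_tilings "\<lambda>_ _. {{(0, 0), (1, 0), (2, 0)}}" "{3}" "{1}"
proof
  fix h w :: nat and A :: "cell set"
  assume "h \<in> {3}" "w \<in> {1}"
  then have "rect h w = {(0, 0), (1, 0), (2, 0)}"
    by (auto simp: rect_def)
  then show "partition_on (rect h w) {{(0, 0), (1, 0), (2, 0)}}"
    by (simp add: partition_on_space)
  assume "A \<in> {{(0, 0), (1, 0), (2, 0)}}"
  then show "tromino A"
    by (simp add: tromino_def linked_def)
qed

text \<open>
  The first two vertical trominoes in the top rows form a rectangle of size 3 by 2, which can
  also be cut into two L-shaped trominoes.
\<close>
lemma not_interlocked_columns:
  "\<not> interlocked (mosaic (\<lambda>_ _. {{(0, 0), (1, 0), (2, 0)}}) (h # hs) (1 # 1 # ws))"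
proof -
  let ?P = "mosaic (\<lambda>_ _. {{(0, 0), (1, 0), (2, 0)}}) (h # hs) (1 # 1 # ws)"
  define A B :: "cell set" where "A = {(0, 0), (1, 0), (2, 0)}" and "B = {(0, 1), (1, 1), (2, 1)}"
  have "B = translate 0 1 A"
    by (simp add: A_def B_def translate_def)
  then have "A \<in> ?P" "B \<in> ?P"
    by (simp_all add: A_def)
  have "insert (0, 1) (A - {(2, 0)}) = {(0, 0), (1, 0), (0, 1)}"
    "insert (2, 0) (B - {(0, 1)}) = {(1, 1), (2, 1), (2, 0)}"
    by (auto simp: A_def B_def)
  then have "linked (insert (0, 1) (A - {(2, 0)}))" "linked (insert (2, 0) (B - {(0, 1)}))"
    by (simp_all add: linked_def)
  moreover have "(2, 0) \<in> A" "(0, 1) \<in> B" "(0, 1) \<notin> A"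
    by (simp_all add: A_def B_def)
  ultimately have "exchangeable A B" "A \<noteq> B"
    unfolding exchangeable_def by blast+
  with \<open>A \<in> ?P\<close> \<open>B \<in> ?P\<close> show ?thesis
    unfolding interlocked_def by blast
qed

section \<open>Filling the grid\<close>

text \<open>
  Sixes suffice for even multiples of 3; an odd multiple uses a single 9.
\<close>
lemma heights_exist:
  assumes "3 dvd m" "m \<ge> 6"
  shows "\<exists>hs. set hs \<subseteq> {6, 9} \<and> sum_list hs = (m :: nat)"
proof -
  from assms(1) obtain k where k: "m = 3 * k"
    by blast
  define hs where "hs = (if even k then replicate (k div 2) 6 else 9 # replicate (k div 2 - 1) (6 :: nat))"
  have "2 \<le> k"
    using assms(2) k by simp
  have "sum_list hs = m"
  proof (cases "even k")
    case True
    then show ?thesis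
      using k by (auto simp: hs_def sum_list_replicate)
  next
    case False
    then obtain l where "k = 2 * l + 1"
      by (rule oddE)
    then show ?thesis
      using k \<open>2 \<le> k\<close> by (simp add: hs_def sum_list_replicate)
  qed
  then show ?thesis
    by (intro exI[of _ hs]) (auto simp: hs_def)
qed

text \<open>
  Using \<open>n mod 8\<close> nines leaves a multiple of 8, namely \<open>8 * (n div 8 - n mod 8)\<close>, and
  \<open>n div 8 \<ge> 7 \<ge> n mod 8\<close>.
\<close>
lemma widths_exist:
  assumes "n \<ge> 56"
  shows "\<exists>ws. set ws \<subseteq> {8, 9} \<and> sum_list ws = (n :: nat)"
proof -
  define x where "x = n div 8 - n mod 8"
  have "8 * x + 9 * (n mod 8) = n"
  proof -
    have "7 \<le> n div 8"
      using div_le_mono[OF assms, of 8] by simp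
    moreover have "n mod 8 < 8"
      by simp
    ultimately show ?thesis
      using div_mult_mod_eq[of n 8] unfolding x_def by linarith
  qed
  then show ?thesis
    by (intro exI[of _ "replicate x 8 @ replicate (n mod 8) 9"]) (auto simp: sum_list_replicate)
qed

theorem theorem3p2:
  fixes m n :: nat
  assumes "3 dvd m" and "m \<ge> 6" and "n \<ge> 100"
  shows "\<exists>P. locked_tiling (grid_graph m n) 3 P"
proof -
  obtain hs where hs: "set hs \<subseteq> {6, 9}" "sum_list hs = m"
    using heights_exist assms(1,2) by blast
  obtain ws where ws: "set ws \<subseteq> {8, 9}" "sum_list ws = n"
    using widths_exist[of n] assms(3) by force
  let ?P = "mosaic block hs ws"
  let ?Q = "mosaic (\<lambda>_ _. {{(0, 0), (1, 0), (2, 0)}}) (replicate (m div 3) 3) (replicate n 1)"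
  have P: "?P \<in> connected_partitions (grid_graph m n) 3"
    using mosaic_in_connected_partitions[OF hs(1) ws(1)] hs(2) ws(2) by simp
  have "interlocked ?P"
    using hs(1) ws(1) by (rule mosaic_interlocked)
  have "set (replicate (m div 3) 3) \<subseteq> {3 :: nat}" "set (replicate n 1) \<subseteq> {1 :: nat}"
    by auto
  from columns.mosaic_in_connected_partitions[OF this]
  have "?Q \<in> connected_partitions (grid_graph (m div 3 * 3) n) 3"
    by (simp add: sum_list_replicate)
  then have Q: "?Q \<in> connected_partitions (grid_graph m n) 3"
    using assms(1) by simp
  obtain k l where kl: "m div 3 = Suc k" "n = Suc (Suc l)"
  proof
    show "m div 3 = Suc (m div 3 - 1)"
      using assms(2) by (simp add: div_greater_zero_iff)
    show "n = Suc (Suc (n - 2))"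
      using assms(3) by simp
  qed
  have "\<not> interlocked ?Q"
    unfolding kl replicate_Suc by (rule not_interlocked_columns)
  with \<open>interlocked ?P\<close> have "?Q \<noteq> ?P"
    by metis
  then have "pverts (metagraph (grid_graph m n) 3) \<noteq> {?P}"
    using Q by (auto simp: metagraph_def)
  then show ?thesis
    using isolated_if_interlocked[OF P \<open>interlocked ?P\<close>] unfolding locked_tiling_def by blast
qed

end
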